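(* Let $n\ge 6$, let $S_n$ be the symmetric group on $n$ letters, and let $m$ be the product of all prime numbers not greater than $n$. Consider the words in four letters $w_1(x_1,x_2,x_3,x_4)=x_2x_1^mx_2^{-1}$, $w_2(x_1,x_2,x_3,x_4)=x_3x_1^mx_3^{-1}$, $w_3(x_1,x_2,x_3,x_4)=x_4x_1^mx_4^{-1}$. Then $w_1,w_2,w_3$ are iterated identities of $S_n$, while their product $w=w_1w_2w_3$ is not an iterated identity of $S_n$.
   Context: For a word $w=w(x_1,\dots,x_n)$ (element of the free group on $x_1,\dots,x_n$), the Engel type iterations on the first variable are $w_{\circ 1}=w$ and $w_{\circ (N+1)}(x_1,\dots,x_n)=w(w_{\circ N}(x_1,\dots,x_n),x_2,\dots,x_n)$ for $N\ge 1$. The word $w$ is an ($E$-type) iterated identity of a group $G$ if for all $x_1,\dots,x_n\in G$ there exists $N\ge 1$ with $w_{\circ N}(x_1,\dots,x_n)=e$ in $G$. *)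

theory Defs
  imports
    "HOL-Algebra.Sym_Groups"
    "HOL-Computational_Algebra.Primes"
begin

section \<open>Free groups\<close>

text \<open>
  The free group on a set \<open>X\<close> is realised by reduced words with concatenation followed by
  free reduction. The letter \<open>(x, True)\<close> stands for the generator \<open>x\<close> and
  \<open>(x, False)\<close> for its formal inverse.
\<close>

type_synonym 'a word = "('a \<times> bool) list"

fun inv_letter :: "'a \<times> bool \<Rightarrow> 'a \<times> bool" where
  "inv_letter (x, b) = (x, \<not> b)"

definition reduced :: "'a word \<Rightarrow> bool" where
  "reduced w \<longleftrightarrow> successively (\<lambda>a b. b \<noteq> inv_letter a) w"

fun cons_reduce :: "'a \<times> bool \<Rightarrow> 'a word \<Rightarrow> 'a word" where
  "cons_reduce a [] = [a]"
| "cons_reduce a (b # w) = (if b = inv_letter a then w else a # b # w)"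

definition reduce :: "'a word \<Rightarrow> 'a word" where
  "reduce w = foldr cons_reduce w []"

definition free_group :: "'a set \<Rightarrow> 'a word monoid" where
  "free_group X =
     \<lparr> carrier = {w. reduced w \<and> fst ` set w \<subseteq> X}, mult = (\<lambda>u v. reduce (u @ v)), one = [] \<rparr>"

definition word_gen :: "'a \<Rightarrow> 'a word" where
  "word_gen x = [(x, True)]"

text \<open>The value \<open>w(f)\<close> of a word in a group when each generator \<open>x\<close> is replaced by \<open>f x\<close>.\<close>

definition word_eval :: "('b, 'c) monoid_scheme \<Rightarrow> ('a \<Rightarrow> 'b) \<Rightarrow> 'a word \<Rightarrow> 'b" where
  "word_eval G f w =
     foldr (\<lambda>(x, b) g. (if b then f x else inv\<^bsub>G\<^esub> f x) \<otimes>\<^bsub>G\<^esub> g) w \<one>\<^bsub>G\<^esub>"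

lemma inv_letter_inv_letter [simp]: "inv_letter (inv_letter a) = a"
  by (cases a) simp

lemma fst_inv_letter [simp]: "fst (inv_letter a) = fst a"
  by (cases a) simp

lemma reduced_Nil [simp]: "reduced []"
  by (simp add: reduced_def)

lemma reduced_Cons:
  "reduced (a # w) \<longleftrightarrow> reduced w \<and> (case w of [] \<Rightarrow> True | b # _ \<Rightarrow> b \<noteq> inv_letter a)"
  by (cases w) (auto simp: reduced_def)

lemma reduced_cons_reduce: "reduced w \<Longrightarrow> reduced (cons_reduce a w)"
  by (cases w) (auto simp: reduced_Cons)

lemma cons_reduce_cancel:
  assumes "reduced w"
  shows "cons_reduce a (cons_reduce (inv_letter a) w) = w"
proof (cases w)
  case (Cons b u)
  show ?thesis
  proof (cases "b = a")
    case True
    with assms Cons show ?thesis by (cases u) (simp_all add: reduced_Cons)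
  qed (simp add: Cons)
qed simp

lemma reduced_foldr: "reduced v \<Longrightarrow> reduced (foldr cons_reduce u v)"
  by (induction u) (auto intro: reduced_cons_reduce)

lemma reduced_reduce [simp]: "reduced (reduce w)"
  by (simp add: reduce_def reduced_foldr)

lemma reduce_reduced: "reduced w \<Longrightarrow> reduce w = w"
proof (induction w)
  case (Cons a w)
  then show ?case by (cases w) (auto simp: reduce_def reduced_Cons)
qed (simp add: reduce_def)

lemma set_cons_reduce: "set (cons_reduce a w) \<subseteq> insert a (set w)"
  by (cases w) auto

lemma set_reduce: "set (reduce w) \<subseteq> set w"
proof (induction w)
  case (Cons a w)
  have "reduce (a # w) = cons_reduce a (reduce w)"
    by (simp add: reduce_def)
  with Cons set_cons_reduce[of a "reduce w"] show ?case by auto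
qed (simp add: reduce_def)

lemma foldr_cons_reduce:
  assumes "reduced v"
  shows "foldr cons_reduce (cons_reduce a w) v = cons_reduce a (foldr cons_reduce w v)"
proof (cases w)
  case (Cons b u)
  then show ?thesis
    using cons_reduce_cancel[OF reduced_foldr[OF assms]] by auto
qed simp

lemma foldr_reduce:
  assumes "reduced v"
  shows "foldr cons_reduce (reduce u) v = foldr cons_reduce u v"
  by (induction u) (simp_all add: reduce_def foldr_cons_reduce assms)

lemma reduce_append: "reduce (u @ v) = foldr cons_reduce u (reduce v)"
  by (simp add: reduce_def)

lemma reduce_append_left [simp]: "reduce (reduce u @ v) = reduce (u @ v)"
  by (simp add: reduce_append foldr_reduce)

lemma reduce_append_right [simp]: "reduce (u @ reduce v) = reduce (u @ v)"
  by (simp add: reduce_append reduce_reduced)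

lemma reduce_left_inverse: "reduce (rev (map inv_letter w) @ w) = []"
proof (induction w)
  case (Cons a w)
  have "reduce (rev (map inv_letter (a # w)) @ a # w)
      = foldr cons_reduce (rev (map inv_letter w))
          (cons_reduce (inv_letter a) (cons_reduce (inv_letter (inv_letter a)) (reduce w)))"
    by (simp add: reduce_def)
  also have "\<dots> = reduce (rev (map inv_letter w) @ w)"
    by (simp only: cons_reduce_cancel[OF reduced_reduce] reduce_append)
  finally show ?case by (simp add: Cons.IH)
qed (simp add: reduce_def)

lemma reduce_closed: "fst ` set w \<subseteq> X \<Longrightarrow> reduce w \<in> carrier (free_group X)"
  using set_reduce[of w] by (auto simp: free_group_def)

lemma group_free_group: "group (free_group X)"
proof (rule groupI)
  fix u assume u: "u \<in> carrier (free_group X)"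
  let ?v = "reduce (rev (map inv_letter u))"
  have "?v \<in> carrier (free_group X)"
    using u by (intro reduce_closed) (auto simp: free_group_def)
  moreover have "?v \<otimes>\<^bsub>free_group X\<^esub> u = \<one>\<^bsub>free_group X\<^esub>"
    by (simp add: free_group_def reduce_left_inverse)
  ultimately show "\<exists>v \<in> carrier (free_group X). v \<otimes>\<^bsub>free_group X\<^esub> u = \<one>\<^bsub>free_group X\<^esub>"
    by blast
next
  fix u v assume "u \<in> carrier (free_group X)" "v \<in> carrier (free_group X)"
  then have "reduce (u @ v) \<in> carrier (free_group X)"
    by (intro reduce_closed) (auto simp: free_group_def)
  then show "u \<otimes>\<^bsub>free_group X\<^esub> v \<in> carrier (free_group X)"
    by (simp add: free_group_def)
qed (auto simp: free_group_def reduce_reduced)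

lemma word_gen_closed: "x \<in> X \<Longrightarrow> word_gen x \<in> carrier (free_group X)"
  by (simp add: free_group_def word_gen_def reduced_def)

section \<open>Iterated identities\<close>

text \<open>
  A word in \<open>k\<close> letters is an element of the free group on \<open>{1..k}\<close>. Its iterations substitute
  the previous iterate for the first letter, the substitution being carried out in the free group;
  the value at \<open>0\<close> is only a convention.
\<close>

fun word_iter :: "nat \<Rightarrow> nat word \<Rightarrow> nat \<Rightarrow> nat word" where
  "word_iter k w 0 = word_gen 1"
| "word_iter k w (Suc 0) = w"
| "word_iter k w (Suc (Suc N)) =
     word_eval (free_group {1..k}) (word_gen(1 := word_iter k w (Suc N))) w"

definition iterated_identity :: "nat \<Rightarrow> nat word \<Rightarrow> ('b, 'c) monoid_scheme \<Rightarrow> bool" where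
  "iterated_identity k w G \<longleftrightarrow>
     (\<forall>x \<in> {1..k} \<rightarrow> carrier G. \<exists>N\<ge>1. word_eval G x (word_iter k w N) = \<one>\<^bsub>G\<^esub>)"

end

(* The iterates of w1, w2, w3 are conjugates of powers of x1 whose exponents are powers of m, and
   some power of m is divisible by n!.  For the product, put g = (1 2 3 4)(5 6).  Since m is twice
   an odd number, g^m = g^2 = (1 3)(2 4), while
     g = (1 2)(2 3)(3 4)(5 6) = [(1 2)(5 6)] [(2 3)(5 6)] [(3 4)(5 6)]
   is a product of three conjugates of (1 3)(2 4).  For suitable x2, x3, x4 the map
   y |-> w(y, x2, x3, x4) therefore fixes g, and no iterate at g vanishes. *)

theory Submission
  imports Defs "HOL-Algebra.Multiplicative_Group"
begin

section \<open>Evaluation of words\<close>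

context group
begin

lemma word_eval_closed:
  assumes "f \<in> X \<rightarrow> carrier G" "fst ` set w \<subseteq> X"
  shows "word_eval G f w \<in> carrier G"
  using assms(2)
proof (induction w)
  case (Cons a w)
  then show ?case using assms(1) by (cases a) (auto simp: word_eval_def)
qed (simp add: word_eval_def)

lemma word_eval_Cons:
  "word_eval G f ((y, b) # w) = (if b then f y else inv f y) \<otimes> word_eval G f w"
  by (simp add: word_eval_def)

lemma word_eval_append:
  assumes "f \<in> X \<rightarrow> carrier G" "fst ` set u \<subseteq> X" "fst ` set v \<subseteq> X"
  shows "word_eval G f (u @ v) = word_eval G f u \<otimes> word_eval G f v"
  using assms(2)
proof (induction u)
  case Nil
  then show ?case using word_eval_closed[OF assms(1,3)] by (simp add: word_eval_def)
next
  case (Cons a u)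
  obtain y b where a: "a = (y, b)" by (cases a)
  have "f y \<in> carrier G" "fst ` set u \<subseteq> X"
    using Cons.prems a assms(1) by auto
  then show ?case
    using Cons.IH word_eval_closed[OF assms(1)] assms(3)
    by (simp add: a word_eval_Cons m_assoc)
qed

text \<open>\<open>cons_reduce\<close> differs from consing only when it deletes a pair of mutually
  inverse letters, and their values cancel in the group as well.\<close>

lemma word_eval_cons_reduce:
  assumes "f \<in> X \<rightarrow> carrier G" "fst a \<in> X" "fst ` set w \<subseteq> X"
  shows "word_eval G f (cons_reduce a w) = word_eval G f (a # w)"
proof (cases w)
  case (Cons b u)
  obtain y c where a: "a = (y, c)" by (cases a)
  have "f y \<in> carrier G" "word_eval G f u \<in> carrier G"
    using assms a Cons word_eval_closed[OF assms(1), of u] by auto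
  then show ?thesis
    by (auto simp: Cons a word_eval_Cons m_assoc[symmetric])
qed simp

lemma word_eval_reduce:
  assumes "f \<in> X \<rightarrow> carrier G" "fst ` set w \<subseteq> X"
  shows "word_eval G f (reduce w) = word_eval G f w"
  using assms(2)
proof (induction w)
  case (Cons a w)
  have "fst ` set (reduce w) \<subseteq> X"
    using set_reduce[of w] Cons.prems by auto
  then have "word_eval G f (reduce (a # w)) = word_eval G f (a # reduce w)"
    using word_eval_cons_reduce[OF assms(1), of a "reduce w"] Cons.prems
    by (simp add: reduce_def)
  with Cons show ?case
    by (cases a) (simp add: word_eval_Cons)
qed (simp add: reduce_def)

text \<open>Existence half of the universal property of the free group: multiplication there is
  concatenation followed by reduction, and evaluation respects both.\<close>

lemma word_eval_group_hom:
  assumes "f \<in> X \<rightarrow> carrier G"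
  shows "group_hom (free_group X) G (word_eval G f)"
proof (intro group_hom.intro group_hom_axioms.intro homI group_free_group)
  fix u v assume "u \<in> carrier (free_group X)" "v \<in> carrier (free_group X)"
  then show "word_eval G f (u \<otimes>\<^bsub>free_group X\<^esub> v) = word_eval G f u \<otimes> word_eval G f v"
    using word_eval_reduce[OF assms, of "u @ v"] word_eval_append[OF assms, of u v]
    by (simp add: free_group_def image_Un)
qed (use word_eval_closed[OF assms] group_axioms in \<open>auto simp: free_group_def\<close>)

lemma word_eval_word_gen [simp]: "f y \<in> carrier G \<Longrightarrow> word_eval G f (word_gen y) = f y"
  by (simp add: word_eval_def word_gen_def)

lemma word_eval_conj_power:
  assumes "f \<in> X \<rightarrow> carrier G" "i \<in> X" "j \<in> X"
  shows "word_eval G f (word_gen j \<otimes>\<^bsub>free_group X\<^esub> word_gen i [^]\<^bsub>free_group X\<^esub> (m :: nat)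
           \<otimes>\<^bsub>free_group X\<^esub> inv\<^bsub>free_group X\<^esub> word_gen j)
         = f j \<otimes> f i [^] m \<otimes> inv f j"
proof -
  interpret h: group_hom "free_group X" G "word_eval G f"
    by (rule word_eval_group_hom[OF assms(1)])
  have "f i \<in> carrier G" "f j \<in> carrier G" using assms by auto
  then show ?thesis
    using assms(2,3) by (simp add: word_gen_closed h.hom_nat_pow)
qed

text \<open>Evaluation under \<open>f\<close> is a homomorphism, so it passes through the letters of
  \<open>w\<close>. This turns substitution in the free group into substitution of values in
  \<open>G\<close>.\<close>

lemma word_eval_word_eval:
  assumes "f \<in> X \<rightarrow> carrier G" "h \<in> Y \<rightarrow> carrier (free_group X)" "fst ` set w \<subseteq> Y"
  shows "word_eval G f (word_eval (free_group X) h w) = word_eval G (\<lambda>y. word_eval G f (h y)) w"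
  using assms(3)
proof (induction w)
  case Nil
  show ?case by (simp add: word_eval_def free_group_def)
next
  case (Cons a w)
  interpret h: group_hom "free_group X" G "word_eval G f"
    by (rule word_eval_group_hom[OF assms(1)])
  obtain y b where a: "a = (y, b)" by (cases a)
  have "h y \<in> carrier (free_group X)" "fst ` set w \<subseteq> Y"
    using Cons.prems a assms(2) by auto
  moreover have "word_eval (free_group X) h w \<in> carrier (free_group X)"
    using h.G.word_eval_closed[OF assms(2)] calculation(2) .
  ultimately show ?case
    using Cons.IH by (simp add: a word_eval_Cons h.G.word_eval_Cons)
qed

lemma word_eval_cong:
  assumes "\<And>y. y \<in> fst ` set w \<Longrightarrow> f y = g y"
  shows "word_eval G f w = word_eval G g w"
  using assms
proof (induction w)
  case (Cons a w)
  then show ?case by (cases a) (simp add: word_eval_Cons)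
qed (simp add: word_eval_def)

end

section \<open>Iterated words\<close>

lemma word_iter_closed:
  assumes "k \<ge> 1" "w \<in> carrier (free_group {1..k})"
  shows "word_iter k w N \<in> carrier (free_group {1..k})"
  using assms
proof (induction k w N rule: word_iter.induct)
  case (3 k w N)
  interpret F: group "free_group {1..k}" by (rule group_free_group)
  have "word_gen(1 := word_iter k w (Suc N)) \<in> {1..k} \<rightarrow> carrier (free_group {1..k})"
    using 3 by (auto simp: word_gen_closed)
  moreover have "fst ` set w \<subseteq> {1..k}"
    using "3.prems" by (simp add: free_group_def)
  ultimately show ?case
    by (simp add: F.word_eval_closed del: One_nat_def)
qed (simp_all add: word_gen_closed)

text \<open>The values of the iterates form the orbit of \<open>f 1\<close> under the self-map of
  \<open>G\<close> that sends y to the value of \<open>w\<close> with y for the first letter. All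
  later arguments use this recursion in \<open>G\<close>.\<close>

lemma (in group) word_eval_word_iter_Suc:
  assumes "k \<ge> 1" "w \<in> carrier (free_group {1..k})" "f \<in> {1..k} \<rightarrow> carrier G"
  shows "word_eval G f (word_iter k w (Suc N))
         = word_eval G (f(1 := word_eval G f (word_iter k w N))) w"
proof (cases N)
  \<comment> \<open>The convention at 0 is the first generator, whose value is \<open>f 1\<close>;
    hence the recursion already holds from 0 to 1.\<close>
  case 0
  have "f 1 \<in> carrier G" using assms by auto
  then have "f(1 := word_eval G f (word_iter k w N)) = f" by (simp add: 0)
  then show ?thesis by (simp add: 0)
next
  case (Suc M)
  have sub: "fst ` set w \<subseteq> {1..k}"
    using assms(2) by (simp add: free_group_def)
  have "word_gen(1 := word_iter k w N) \<in> {1..k} \<rightarrow> carrier (free_group {1..k})"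
    using word_iter_closed[OF assms(1,2)] by (auto simp: word_gen_closed)
  then have "word_eval G f (word_iter k w (Suc N))
      = word_eval G (\<lambda>y. word_eval G f ((word_gen(1 := word_iter k w N)) y)) w"
    using word_eval_word_eval[OF assms(3) _ sub] by (simp add: Suc)
  also have "\<dots> = word_eval G (f(1 := word_eval G f (word_iter k w N))) w"
    using sub assms(3) by (intro word_eval_cong) (auto intro!: word_eval_word_gen)
  finally show ?thesis .
qed

section \<open>Criteria for and against iterated identities\<close>

lemma (in group) conj_pow:
  assumes "a \<in> carrier G" "g \<in> carrier G"
  shows "(a \<otimes> g \<otimes> inv a) [^] (r :: nat) = a \<otimes> g [^] r \<otimes> inv a"
proof (induction r)
  case (Suc r)
  have "a \<otimes> g [^] r \<otimes> inv a \<otimes> (a \<otimes> g \<otimes> inv a) = a \<otimes> (g [^] r \<otimes> g) \<otimes> inv a"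
    using assms by (simp add: m_assoc inv_solve_left')
  then show ?case using Suc by simp
qed (use assms in simp)

text \<open>Each iteration raises the previous value to the power \<open>m\<close> and conjugates it
  by \<open>f j\<close>, which stays the same because \<open>j\<close> is not the iterated letter.
  After \<open>N\<close> iterations the exponent \<open>m ^ N\<close> kills the group.\<close>

lemma (in group) iterated_identity_conj_power:
  fixes m N :: nat
  assumes j: "j \<in> {1..k}" "j \<noteq> 1"
    and N: "N \<ge> 1" "\<And>g. g \<in> carrier G \<Longrightarrow> g [^] (m ^ N) = \<one>"
  shows "iterated_identity k (word_gen j \<otimes>\<^bsub>free_group {1..k}\<^esub>
           word_gen 1 [^]\<^bsub>free_group {1..k}\<^esub> m \<otimes>\<^bsub>free_group {1..k}\<^esub>
           inv\<^bsub>free_group {1..k}\<^esub> word_gen j) G"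
    (is "iterated_identity k ?w G")
  unfolding iterated_identity_def
proof
  interpret F: group "free_group {1..k}" by (rule group_free_group)
  fix f assume f: "f \<in> {1..k} \<rightarrow> carrier G"
  have one: "1 \<in> {1..k}" using j by auto
  have w: "?w \<in> carrier (free_group {1..k})"
    using j one by (simp add: word_gen_closed del: One_nat_def)
  let ?v = "\<lambda>M. word_eval G f (word_iter k ?w M)"
  have fj: "f j \<in> carrier G" "f 1 \<in> carrier G"
    using f j one by auto
  have v: "?v M \<in> carrier G" for M
    using word_iter_closed[OF _ w, of M] one word_eval_closed[OF f]
    by (simp add: free_group_def)
  have step: "?v (Suc M) = f j \<otimes> ?v M [^] m \<otimes> inv f j" for M
  proof -
    have "f(1 := ?v M) \<in> {1..k} \<rightarrow> carrier G" using f v by auto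
    from word_eval_conj_power[OF this one j(1), of m] show ?thesis
      using word_eval_word_iter_Suc[OF _ w f, of M] one j(2) by simp
  qed
  \<comment> \<open>The extra exponent \<open>r\<close> avoids tracking the accumulated conjugator:
    each iteration uses up one factor \<open>m\<close> of the exponent, and conjugation preserves
    triviality. The case \<open>r = 0\<close> is the one wanted.\<close>
  have "?v M [^] (m ^ r) = \<one>" if "f 1 [^] (m ^ (M + r)) = \<one>" for M r
    using that
  proof (induction M arbitrary: r)
    case 0
    then show ?case using fj by simp
  next
    case (Suc M)
    have "?v M [^] (m ^ Suc r) = \<one>"
      using Suc.prems by (intro Suc.IH) simp
    then have "(?v M [^] m) [^] (m ^ r) = \<one>"
      using v by (simp add: nat_pow_pow)
    then show ?case
      using fj v by (simp only: step conj_pow nat_pow_closed) simp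
  qed
  from this[where M = N and r = 0] have "?v N = \<one>"
    using N(2)[OF fj(2)] v by simp
  with N(1) show "\<exists>N\<ge>1. ?v N = \<one>" by blast
qed

text \<open>The orbit of a fixed point is constant, so it never reaches the neutral element unless
  it starts there.\<close>

lemma (in group) not_iterated_identity_if_fixed:
  assumes "k \<ge> 1" "w \<in> carrier (free_group {1..k})" "f \<in> {1..k} \<rightarrow> carrier G"
    and "word_eval G f w = f 1" "f 1 \<noteq> \<one>"
  shows "\<not> iterated_identity k w G"
proof -
  have "word_eval G f (word_iter k w N) = f 1" for N
  proof (induction N)
    case 0
    show ?case using assms(1,3) by (auto intro: word_eval_word_gen)
  next
    case (Suc N)
    have "f(1 := f 1) = f" by simp
    then show ?case
      using assms(4) by (simp only: word_eval_word_iter_Suc[OF assms(1-3)] Suc.IH)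
  qed
  with assms(3,5) show ?thesis unfolding iterated_identity_def by metis
qed

section \<open>Products of primes\<close>

text \<open>The number of prime factors of \<open>a\<close>, counted with multiplicity, serves as
  \<open>N\<close>: each of these factors divides one copy of \<open>b\<close>.\<close>

lemma dvd_power_if_prime_divisors:
  fixes a b :: nat
  assumes "a > 0" "\<And>p. prime p \<Longrightarrow> p dvd a \<Longrightarrow> p dvd b"
  shows "\<exists>N. a dvd b ^ N"
proof -
  have "prod_mset A dvd b ^ size A" if "\<And>p. p \<in># A \<Longrightarrow> p dvd b" for A
    using that by (induction A) (auto intro: mult_dvd_mono)
  from this[of "prime_factorization a"] show ?thesis
    using assms by (auto simp: prod_mset_prime_factorization_nat intro: in_prime_factors_imp_dvd)
qed

text \<open>The primes dividing \<open>fact n\<close> are those up to \<open>n\<close>. As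
  \<open>fact n\<close> is the order of the symmetric group, a power of the primorial is an exponent
  of it.\<close>

lemma fact_dvd_power_primorial: "\<exists>N. fact n dvd (\<Prod>{p :: nat. prime p \<and> p \<le> n}) ^ N"
proof (rule dvd_power_if_prime_divisors)
  fix p :: nat assume "prime p" "p dvd fact n"
  then have "p \<in> {p. prime p \<and> p \<le> n}" by (simp add: prime_dvd_fact_iff)
  then show "p dvd \<Prod>{p. prime p \<and> p \<le> n}"
    using dvd_prodI[of "{p. prime p \<and> p \<le> n}" p "\<lambda>p. p"] by simp
qed simp

text \<open>The prime 2 occurs exactly once and all other factors are odd.\<close>

lemma primorial_mod_4:
  fixes n :: nat
  assumes "n \<ge> 2"
  shows "\<Prod>{p :: nat. prime p \<and> p \<le> n} mod 4 = 2"
proof -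
  let ?P = "{p :: nat. prime p \<and> p \<le> n}"
  have "\<Prod>?P = 2 * \<Prod>(?P - {2})"
    using assms by (subst prod.remove[of _ 2]) auto
  moreover have "odd (\<Prod>(?P - {2}))"
    by (auto simp: even_prod_iff dest: primes_dvd_imp_eq[OF two_is_prime_nat])
  ultimately show ?thesis by (elim oddE) (simp, presburger)
qed

section \<open>Permutations\<close>

text \<open>Multiplying by \<open>p\<close> on the right leaves an equation without inverses, which
  can be checked pointwise for explicit permutations.\<close>

lemma sym_group_conj_eqI:
  assumes "p \<in> carrier (sym_group n)" "q \<in> carrier (sym_group n)"
    and "p \<circ> q = r \<circ> p"
  shows "p \<otimes>\<^bsub>sym_group n\<^esub> q \<otimes>\<^bsub>sym_group n\<^esub> inv\<^bsub>sym_group n\<^esub> p = r"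
proof -
  have "p \<circ> inv' p = id"
    using assms(1) permutes_inv_o(1) by (auto simp: sym_group_carrier)
  then show ?thesis
    using assms by (simp add: sym_group_mult comp_assoc)
qed

theorem mainTheorem5:
  fixes n m :: nat and F :: "nat word monoid"
    and x w1 w2 w3
  assumes "n \<ge> 6"
    and "m = \<Prod>{p. prime p \<and> p \<le> n}"
    and "F = free_group {1..4}"
    and "x = word_gen"
    and "w1 = x 2 \<otimes>\<^bsub>F\<^esub> x 1 [^]\<^bsub>F\<^esub> m \<otimes>\<^bsub>F\<^esub> inv\<^bsub>F\<^esub> x 2"
    and "w2 = x 3 \<otimes>\<^bsub>F\<^esub> x 1 [^]\<^bsub>F\<^esub> m \<otimes>\<^bsub>F\<^esub> inv\<^bsub>F\<^esub> x 3"
    and "w3 = x 4 \<otimes>\<^bsub>F\<^esub> x 1 [^]\<^bsub>F\<^esub> m \<otimes>\<^bsub>F\<^esub> inv\<^bsub>F\<^esub> x 4"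
  shows "iterated_identity 4 w1 (sym_group n) \<and>
    iterated_identity 4 w2 (sym_group n) \<and>
    iterated_identity 4 w3 (sym_group n) \<and>
    \<not> iterated_identity 4 (w1 \<otimes>\<^bsub>F\<^esub> w2 \<otimes>\<^bsub>F\<^esub> w3) (sym_group n)"
proof -
  interpret S: group "sym_group n" by (rule sym_group_is_group)

  \<comment> \<open>The three factors are iterated identities\<close>
  obtain N where N: "fact n dvd m ^ N"
    using fact_dvd_power_primorial assms(2) by blast
  \<comment> \<open>Lagrange's theorem with group order \<open>fact n\<close>; using
    \<open>Suc N\<close> makes the number of iterations at least 1.\<close>
  have exponent: "g [^]\<^bsub>sym_group n\<^esub> (m ^ Suc N) = \<one>\<^bsub>sym_group n\<^esub>"
    if g: "g \<in> carrier (sym_group n)" for g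
  proof -
    obtain c where "m ^ Suc N = fact n * c"
      using N by (metis dvdE dvd_mult power_Suc)
    then show ?thesis
      using S.pow_order_eq_1[OF g] g
      by (simp add: order_def sym_group_card_carrier flip: S.nat_pow_pow)
  qed
  note iter = S.iterated_identity_conj_power[where k = 4 and m = m, OF _ _ _ exponent,
      folded assms(3), folded assms(4)]
  have "iterated_identity 4 w1 (sym_group n)" "iterated_identity 4 w2 (sym_group n)"
    "iterated_identity 4 w3 (sym_group n)"
    unfolding assms(5-7) by (rule iter; simp)+

  \<comment> \<open>A nontrivial fixed point for the product\<close>
  moreover have "\<not> iterated_identity 4 (w1 \<otimes>\<^bsub>F\<^esub> w2 \<otimes>\<^bsub>F\<^esub> w3) (sym_group n)"
  proof -
    interpret F: group F unfolding assms(3) by (rule group_free_group)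
    let ?t = "transpose :: nat \<Rightarrow> nat \<Rightarrow> nat \<Rightarrow> nat"
    define g where "g = ?t 1 2 \<circ> ?t 2 3 \<circ> ?t 3 4 \<circ> ?t 5 6"
    \<comment> \<open>Conjugation by p turns \<open>h\<close>, that is (1 3)(2 4), into (p(1)
      p(3))(p(2) p(4)). All three conjugators send 2, 4 to 5, 6, while \<open>p2\<close>,
      \<open>p3\<close>, \<open>p4\<close> send 1, 3 to 1, 2, to 2, 3 and to 3, 4
      respectively.\<close>
    define p2 where "p2 = ?t 2 3 \<circ> ?t 2 5 \<circ> ?t 4 6"
    define p3 where "p3 = ?t 1 5 \<circ> ?t 1 2 \<circ> ?t 4 6"
    define p4 where "p4 = ?t 1 6 \<circ> ?t 1 4 \<circ> ?t 1 3 \<circ> ?t 2 5"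
    define h where "h = ?t 1 3 \<circ> ?t 2 4"
    \<comment> \<open>Here \<open>n \<ge> 6\<close> makes room for the six letters.\<close>
    have t: "?t a b \<in> carrier (sym_group n)" if "a \<in> {1..6}" "b \<in> {1..6}" for a b
      using that assms(1) by (auto simp: sym_group_carrier intro: permutes_swap_id)
    have comp: "p \<circ> q \<in> carrier (sym_group n)"
      if "p \<in> carrier (sym_group n)" "q \<in> carrier (sym_group n)" for p q
      using S.m_closed[OF that] by (simp add: sym_group_mult)
    have closed: "g \<in> carrier (sym_group n)" "h \<in> carrier (sym_group n)"
      "p2 \<in> carrier (sym_group n)" "p3 \<in> carrier (sym_group n)" "p4 \<in> carrier (sym_group n)"
      unfolding g_def h_def p2_def p3_def p4_def by (intro comp t; simp)+

    have gg: "g \<circ> g = h"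
      unfolding g_def h_def by (auto simp: fun_eq_iff transpose_def)
    have hh: "h \<circ> h = id"
      unfolding h_def by (auto simp: fun_eq_iff transpose_def)
    \<comment> \<open>The fourth power of \<open>g\<close> is trivial, so only the residue 2 of
      \<open>m\<close> modulo 4 matters.\<close>
    have "m = 2 + 4 * (m div 4)"
      using primorial_mod_4[of n] assms(1,2) by presburger
    moreover have "g [^]\<^bsub>sym_group n\<^esub> (2 :: nat) = h"
      using gg closed by (simp add: numeral_2_eq_2 sym_group_mult sym_group_one)
    moreover have "g [^]\<^bsub>sym_group n\<^esub> (4 :: nat) = \<one>\<^bsub>sym_group n\<^esub>"
    proof -
      have "g [^]\<^bsub>sym_group n\<^esub> (2 * 2 :: nat) = h [^]\<^bsub>sym_group n\<^esub> (2 :: nat)"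
        using calculation(2) closed S.nat_pow_pow by metis
      also have "\<dots> = \<one>\<^bsub>sym_group n\<^esub>"
        using hh closed by (simp add: numeral_2_eq_2 sym_group_mult sym_group_one)
      finally show ?thesis by simp
    qed
    ultimately have gm: "g [^]\<^bsub>sym_group n\<^esub> m = h"
      using closed by (metis S.nat_pow_mult S.nat_pow_pow S.nat_pow_one S.r_one)

    have conj: "p2 \<otimes>\<^bsub>sym_group n\<^esub> h \<otimes>\<^bsub>sym_group n\<^esub> inv\<^bsub>sym_group n\<^esub> p2 = ?t 1 2 \<circ> ?t 5 6"
      "p3 \<otimes>\<^bsub>sym_group n\<^esub> h \<otimes>\<^bsub>sym_group n\<^esub> inv\<^bsub>sym_group n\<^esub> p3 = ?t 2 3 \<circ> ?t 5 6"
      "p4 \<otimes>\<^bsub>sym_group n\<^esub> h \<otimes>\<^bsub>sym_group n\<^esub> inv\<^bsub>sym_group n\<^esub> p4 = ?t 3 4 \<circ> ?t 5 6"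
      using closed by (intro sym_group_conj_eqI;
        auto simp: h_def p2_def p3_def p4_def fun_eq_iff transpose_def)+

    \<comment> \<open>The iterated letter gets the intended fixed point \<open>g\<close>, the other
      letters get the conjugators; the default \<open>id\<close> is the neutral element.\<close>
    define f :: "nat \<Rightarrow> nat \<Rightarrow> nat"
      where "f = (\<lambda>_. id)(1 := g, 2 := p2, 3 := p3, 4 := p4)"
    have f: "f \<in> {1..4} \<rightarrow> carrier (sym_group n)"
      using closed S.one_closed by (auto simp: f_def sym_group_one)
    interpret h: group_hom F "sym_group n" "word_eval (sym_group n) f"
      unfolding assms(3) by (rule S.word_eval_group_hom[OF f])
    have x: "x i \<in> carrier F" if "i \<in> {1..4}" for i
      unfolding assms(3,4) using that by (rule word_gen_closed)
    have w: "w1 \<in> carrier F" "w2 \<in> carrier F" "w3 \<in> carrier F"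
      unfolding assms(5-7) by (simp_all add: x)
    note eval = S.word_eval_conj_power[OF f, of 1 _ m, folded assms(3), folded assms(4)]
    have "word_eval (sym_group n) f w1 = ?t 1 2 \<circ> ?t 5 6"
      "word_eval (sym_group n) f w2 = ?t 2 3 \<circ> ?t 5 6"
      "word_eval (sym_group n) f w3 = ?t 3 4 \<circ> ?t 5 6"
      using conj eval[of 2] eval[of 3] eval[of 4]
      unfolding assms(5-7) by (simp_all add: f_def gm del: sym_group_inv_equality)
    then have "word_eval (sym_group n) f (w1 \<otimes>\<^bsub>F\<^esub> w2 \<otimes>\<^bsub>F\<^esub> w3)
        = (?t 1 2 \<circ> ?t 5 6) \<circ> (?t 2 3 \<circ> ?t 5 6) \<circ> (?t 3 4 \<circ> ?t 5 6)"
      using w by (simp add: sym_group_mult)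
    \<comment> \<open>The transposition (5 6) commutes with the others and occurs three times, so a
      single copy survives, as in \<open>g\<close>.\<close>
    also have "\<dots> = f 1"
      by (auto simp: f_def g_def fun_eq_iff transpose_def)
    finally have "word_eval (sym_group n) f (w1 \<otimes>\<^bsub>F\<^esub> w2 \<otimes>\<^bsub>F\<^esub> w3) = f 1" .
    moreover have "f 1 \<noteq> \<one>\<^bsub>sym_group n\<^esub>"
    proof
      assume "f 1 = \<one>\<^bsub>sym_group n\<^esub>"
      then have "g 1 = 1" by (simp add: f_def sym_group_one)
      then show False by (simp add: g_def transpose_def)
    qed
    ultimately show ?thesis
      using w f by (intro S.not_iterated_identity_if_fixed[where f = f and k = 4, folded assms(3)])
        simp_all
  qed
  ultimately show ?thesis by blast
qed

end
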